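(* Consider the data-driven linear program $$\mathrm{(LP)}\qquad \max_{\alpha}\ \alpha^\top\int_{\mathbf{Z}}\phi(z)\,c(dz)\quad\text{s.t.}\quad \mathbf{\Phi}^\top\alpha\le\boldsymbol{\ell},$$ with $q(z)=\alpha^\top\phi(z)$ restricted to the class $\mathcal{S}^{\mathrm{poly}}$ of polynomial features (all objects are defined in the context). If $q\in\mathcal{S}^{\mathrm{poly}}$, then the solution to (LP) is finite if there exist $\lambda\in\mathbb{R}^N_+\setminus\{0\}$ and $\mu\in\mathbb{R}^M_+\setminus\{0\}$ such that $$\mathrm{mat}(\mathbf{\Phi}\lambda)=\mathrm{mat}(\mathbf{\Phi}_A\mu),$$ where $\mathrm{mat}(\mathbf{\Phi}_A\mu)=\sum_{i=1}^M\mu_i\,p(y_i)p(y_i)^\top$. In that case, (LP) is guaranteed to be bounded by selecting $\int_{\mathbf{Z}}\phi(z)\,c(dz)=\mathbf{\Phi}\lambda$ as the cost vector (equivalently, $\mathbf{\Phi}_A\mu$).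
   Context: Let $\mathbf{X}\subseteq\mathbb{R}^n$, $\mathbf{U}\subseteq\mathbb{R}^m$, $\mathbf{Z}=\mathbf{X}\times\mathbf{U}$. The dynamics are $x^+=f(x,u)$ with $f:\mathbf{X}\times\mathbf{U}\to\mathbf{X}$, the stage cost is $\ell:\mathbf{X}\times\mathbf{U}\to\mathbb{R}_+$ (nonnegative), and the discount factor is $\gamma\in(0,1)$. Data: for $i=1,\dots,N$, $z_i=(x_i,u_i)\in\mathbf{Z}$, $x_i^+=f(x_i,u_i)$, $w_i\in\mathbf{U}$, $z_i^+=(x_i^+,w_i)\in\mathbf{Z}$, $\ell_i=\ell(z_i)$, and $\boldsymbol{\ell}=[\ell_1\ \cdots\ \ell_N]^\top$. $\mathcal{S}(\mathbf{Z})$ is the vector space of real-valued measurable functions on $\mathbf{Z}$ with finite weighted sup-norm (for a fixed positive weight function), and $\mathcal{M}_+(\mathbf{Z})$ is the set of finite nonnegative measures $c$ on $\mathbf{Z}$ with finite weighted total variation and $c(\mathbf{Z})>0$. The measure in (LP) is $c\in\mathcal{M}_+(\mathbf{Z})$. Polynomial features: $p(z)\in\mathbb{R}^\rho$, $\rho=\binom{n+m+d}{d}$, is the complete vector of monomials in $z$ of degree at most $d$; $\phi(z)=\mathrm{vec}(p(z)p(z)^\top)$; $\alpha=\mathrm{vec}\,Q$ with $Q$ a symmetric $\rho\times\rho$ matrix; and $\mathcal{S}^{\mathrm{poly}}$ is the set of $q\in\mathcal{S}(\mathbf{Z})$ of the form $q(z)=\alpha^\top\phi(z)=p(z)^\top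 Q\,p(z)$. The data matrix is $\mathbf{\Phi}=[\phi(z_1)-\gamma\phi(z_1^+)\ \cdots\ \phi(z_N)-\gamma\phi(z_N^+)]$, and for $\lambda\in\mathbb{R}^N$ the matrix version of $\mathbf{\Phi}\lambda$ is $$\mathrm{mat}(\mathbf{\Phi}\lambda)=\sum_{i=1}^N\lambda_i\left(p(z_i)p(z_i)^\top-\gamma\,p(z_i^+)p(z_i^+)^\top\right).$$ The auxiliary data matrix is $\mathbf{\Phi}_A=[\phi(y_1)\ \cdots\ \phi(y_M)]$, where $y_1,\dots,y_M\in\mathbf{Z}$ are vectors in the state-action space sampled according to a given distribution. $\mathbb{R}^N_+$ is the set of vectors in $\mathbb{R}^N$ with nonnegative entries (similarly $\mathbb{R}^M_+$). The "cost vector" of (LP) is the vector $\int_{\mathbf{Z}}\phi(z)\,c(dz)$ multiplying $\alpha$ in the objective. *)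

theory Defs
  imports "HOL-Analysis.Analysis" "HOL-Library.Multiset"
begin

section \<open>Function and measure spaces\<close>

text \<open>
  Sets of states, actions and pairs carry the Borel sets of the ambient Euclidean space, restricted
  to the set. The weighted sup-norm is \<open>sup |q| / w\<close> and the dual weighted total variation of
  a nonnegative measure \<open>c\<close> is the integral of \<open>w\<close> against \<open>c\<close>.
  Functions on \<open>Z\<close> are total functions, of which only the values on \<open>Z\<close> matter.
\<close>

definition S_space :: "('z::topological_space \<Rightarrow> real) \<Rightarrow> 'z set \<Rightarrow> ('z \<Rightarrow> real) set" where
  "S_space w Z =
     {q. q \<in> borel_measurable (restrict_space borel Z) \<and> bdd_above ((\<lambda>z. \<bar>q z\<bar> / w z) ` Z)}"

definition M_plus :: "('z::topological_space \<Rightarrow> real) \<Rightarrow> 'z set \<Rightarrow> 'z measure set" where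
  "M_plus w Z =
     {c. sets c = sets (restrict_space borel Z) \<and> finite_measure c \<and>
         (\<integral>\<^sup>+z. ennreal (w z) \<partial>c) < \<infinity> \<and> emeasure c Z > 0}"


section \<open>Polynomial features\<close>

definition coord :: "(real^'n) \<times> (real^'m) \<Rightarrow> 'n + 'm \<Rightarrow> real" where
  "coord z i = (case i of Inl j \<Rightarrow> fst z $ j | Inr k \<Rightarrow> snd z $ k)"

definition monomial :: "('n::finite + 'm::finite \<Rightarrow> nat) \<Rightarrow> (real^'n) \<times> (real^'m) \<Rightarrow> real" where
  "monomial \<beta> z = (\<Prod>i\<in>UNIV. coord z i ^ \<beta> i)"

definition multi_indices :: "nat \<Rightarrow> ('i::finite \<Rightarrow> nat) set" where
  "multi_indices d = {\<beta>. (\<Sum>i\<in>UNIV. \<beta> i) \<le> d}"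

text \<open>
  The vector of monomials is indexed by a finite type \<open>'r\<close> together with an enumeration
  \<open>e\<close> of the multi-indices. It is the complete vector of monomials of degree at most
  \<open>d\<close> if \<open>e\<close> is a bijection onto \<open>multi_indices d\<close>, which forces
  \<open>CARD('r)\<close> to be the expected binomial coefficient (lemma \<open>CARD_monomials\<close> below).
\<close>

definition pvec ::
  "('r::finite \<Rightarrow> 'n::finite + 'm::finite \<Rightarrow> nat) \<Rightarrow> (real^'n) \<times> (real^'m) \<Rightarrow> real^'r" where
  "pvec e z = (\<chi> r. monomial (e r) z)"

text \<open>
  The vectorisation of a square matrix is indexed by pairs of indices, so that no order of stacking
  has to be fixed.
\<close>

definition vectorize :: "real^'r^'r \<Rightarrow> real^('r \<times> 'r)" where
  "vectorize Q = (\<chi> ij. Q $ fst ij $ snd ij)"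

definition unvectorize :: "real^('r \<times> 'r) \<Rightarrow> real^'r^'r" where
  "unvectorize v = (\<chi> i j. v $ (i, j))"

definition outer :: "real^'r \<Rightarrow> real^'r^'r" where
  "outer v = (\<chi> i j. v $ i * v $ j)"

definition phi ::
  "('r::finite \<Rightarrow> 'n::finite + 'm::finite \<Rightarrow> nat) \<Rightarrow> (real^'n) \<times> (real^'m) \<Rightarrow> real^('r \<times> 'r)" where
  "phi e z = vectorize (outer (pvec e z))"

definition S_poly ::
  "('r::finite \<Rightarrow> 'n::finite + 'm::finite \<Rightarrow> nat) \<Rightarrow> ((real^'n) \<times> (real^'m) \<Rightarrow> real)
    \<Rightarrow> ((real^'n) \<times> (real^'m)) set \<Rightarrow> ((real^'n) \<times> (real^'m) \<Rightarrow> real) set" where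
  "S_poly e w Z =
     {q \<in> S_space w Z. \<exists>Q. transpose Q = Q \<and> (\<forall>z\<in>Z. q z = pvec e z \<bullet> (Q *v pvec e z))}"


section \<open>Data matrices and the data-driven linear program\<close>

definition Phi ::
  "('r::finite \<Rightarrow> 'n::finite + 'm::finite \<Rightarrow> nat) \<Rightarrow> real \<Rightarrow> ('N::finite \<Rightarrow> (real^'n) \<times> (real^'m))
    \<Rightarrow> ('N \<Rightarrow> (real^'n) \<times> (real^'m)) \<Rightarrow> real^'N^('r \<times> 'r)" where
  "Phi e \<gamma> z zp = (\<chi> r i. (phi e (z i) - \<gamma> *\<^sub>R phi e (zp i)) $ r)"

definition Phi_A ::
  "('r::finite \<Rightarrow> 'n::finite + 'm::finite \<Rightarrow> nat) \<Rightarrow> ('M::finite \<Rightarrow> (real^'n) \<times> (real^'m))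
    \<Rightarrow> real^'M^('r \<times> 'r)" where
  "Phi_A e y = (\<chi> r i. phi e (y i) $ r)"

definition lp_feasible ::
  "('r::finite \<Rightarrow> 'n::finite + 'm::finite \<Rightarrow> nat) \<Rightarrow> ((real^'n) \<times> (real^'m) \<Rightarrow> real)
    \<Rightarrow> ((real^'n) \<times> (real^'m)) set \<Rightarrow> real^'N^('r \<times> 'r) \<Rightarrow> real^'N
    \<Rightarrow> (real^('r \<times> 'r)) set" where
  "lp_feasible e w Z A b =
     {\<alpha>. (\<exists>Q. transpose Q = Q \<and> \<alpha> = vectorize Q) \<and> (\<lambda>z. \<alpha> \<bullet> phi e z) \<in> S_poly e w Z \<and>
         transpose A *v \<alpha> \<le> b}"

definition lp_objective ::
  "('r::finite \<Rightarrow> 'n::finite + 'm::finite \<Rightarrow> nat) \<Rightarrow> ((real^'n) \<times> (real^'m)) measure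
    \<Rightarrow> real^('r \<times> 'r) \<Rightarrow> real" where
  "lp_objective e c \<alpha> = \<alpha> \<bullet> (\<integral>z. phi e z \<partial>c)"

definition lp_value ::
  "('r::finite \<Rightarrow> 'n::finite + 'm::finite \<Rightarrow> nat) \<Rightarrow> ((real^'n) \<times> (real^'m) \<Rightarrow> real)
    \<Rightarrow> ((real^'n) \<times> (real^'m)) set \<Rightarrow> real^'N^('r \<times> 'r) \<Rightarrow> real^'N
    \<Rightarrow> ((real^'n) \<times> (real^'m)) measure \<Rightarrow> ereal" where
  "lp_value e w Z A b c = (SUP \<alpha>\<in>lp_feasible e w Z A b. ereal (lp_objective e c \<alpha>))"

text \<open>
  The program has a finite solution: its value is neither \<open>\<infinity>\<close> (unbounded) nor
  \<open>-\<infinity>\<close> (infeasible), and the maximum is attained.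
\<close>

definition lp_finite ::
  "('r::finite \<Rightarrow> 'n::finite + 'm::finite \<Rightarrow> nat) \<Rightarrow> ((real^'n) \<times> (real^'m) \<Rightarrow> real)
    \<Rightarrow> ((real^'n) \<times> (real^'m)) set \<Rightarrow> real^'N^('r \<times> 'r) \<Rightarrow> real^'N
    \<Rightarrow> ((real^'n) \<times> (real^'m)) measure \<Rightarrow> bool" where
  "lp_finite e w Z A b c \<longleftrightarrow>
     \<bar>lp_value e w Z A b c\<bar> \<noteq> \<infinity> \<and>
     (\<exists>\<alpha>\<in>lp_feasible e w Z A b. ereal (lp_objective e c \<alpha>) = lp_value e w Z A b c)"


section \<open>Consistency of the definitions\<close>

lemma unvectorize_vectorize: "unvectorize (vectorize Q) = Q"
  by (simp add: unvectorize_def vectorize_def vec_eq_iff)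

lemma vectorize_unvectorize: "vectorize (unvectorize v) = v"
  by (simp add: unvectorize_def vectorize_def vec_eq_iff)

lemma inner_vectorize_phi:
  fixes Q :: "real^'r^'r"
  shows "vectorize Q \<bullet> phi e z = pvec e z \<bullet> (Q *v pvec e z)"
proof -
  have "vectorize Q \<bullet> phi e z =
      (\<Sum>ij\<in>UNIV \<times> UNIV. Q $ fst ij $ snd ij * (pvec e z $ fst ij * pvec e z $ snd ij))"
    by (simp add: inner_vec_def vectorize_def phi_def outer_def)
  also have "\<dots> = (\<Sum>i\<in>UNIV. \<Sum>j\<in>UNIV. Q $ i $ j * (pvec e z $ i * pvec e z $ j))"
    by (simp add: sum.cartesian_product case_prod_beta)
  also have "\<dots> = pvec e z \<bullet> (Q *v pvec e z)"
    by (simp add: inner_vec_def matrix_vector_mult_def sum_distrib_left algebra_simps)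
  finally show ?thesis .
qed

lemma unvectorize_Phi:
  "unvectorize (Phi e \<gamma> z zp *v v) =
     (\<Sum>i\<in>UNIV. v $ i *\<^sub>R (outer (pvec e (z i)) - \<gamma> *\<^sub>R outer (pvec e (zp i))))"
  by (simp add: vec_eq_iff unvectorize_def Phi_def phi_def vectorize_def matrix_vector_mult_def
      mult.commute)

lemma unvectorize_Phi_A:
  "unvectorize (Phi_A e y *v v) = (\<Sum>i\<in>UNIV. v $ i *\<^sub>R outer (pvec e (y i)))"
  by (simp add: vec_eq_iff unvectorize_def Phi_A_def phi_def vectorize_def matrix_vector_mult_def
      mult.commute)

lemma sum_count_UNIV:
  fixes M :: "'a::finite multiset"
  shows "(\<Sum>x\<in>UNIV. count M x) = size M"
  by (simp add: size_multiset_overloaded_eq)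
     (rule sum.mono_neutral_right, auto simp: not_in_iff)

lemma card_multi_indices:
  "card (multi_indices d :: ('i::finite \<Rightarrow> nat) set) = (CARD('i) + d) choose d"
proof -
  let ?g = "\<lambda>(M::'i option multiset) i. count M (Some i)"
  have size: "size M = count M None + (\<Sum>i\<in>UNIV. count M (Some i))"
    for M :: "'i option multiset"
    by (simp add: sum_count_UNIV[symmetric] UNIV_option_conv sum.reindex)
  have "bij_betw ?g (multisets_of_size UNIV d) (multi_indices d)"
  proof (rule bij_betw_imageI)
    show "inj_on ?g (multisets_of_size UNIV d)"
    proof (rule inj_onI)
      fix M M' :: "'i option multiset"
      assume M: "M \<in> multisets_of_size UNIV d" "M' \<in> multisets_of_size UNIV d"
        and eq: "?g M = ?g M'"
      have some: "count M (Some i) = count M' (Some i)" for i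
        using eq by (rule fun_cong)
      have "count M None = count M' None"
        using M size[of M] size[of M'] some by (simp add: multisets_of_size_def)
      then have "count M x = count M' x" for x
        using some by (cases x) auto
      then show "M = M'" by (rule multiset_eqI)
    qed
    show "?g ` multisets_of_size UNIV d = multi_indices d"
    proof
      show "?g ` multisets_of_size UNIV d \<subseteq> multi_indices d"
        using size by (auto simp: multisets_of_size_def multi_indices_def)
      show "multi_indices d \<subseteq> ?g ` multisets_of_size UNIV d"
      proof
        fix \<beta> :: "'i \<Rightarrow> nat"
        assume b: "\<beta> \<in> multi_indices d"
        define h where "h x = (case x of None \<Rightarrow> d - sum \<beta> UNIV | Some i \<Rightarrow> \<beta> i)" for x
        have cnt: "count (Abs_multiset h) = h"
          by (rule Abs_multiset_inverse) simp
        have "size (Abs_multiset h) = d"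
          using b unfolding size cnt by (simp add: h_def multi_indices_def)
        then have "Abs_multiset h \<in> multisets_of_size UNIV d"
          by (simp add: multisets_of_size_def)
        moreover have "?g (Abs_multiset h) = \<beta>"
          unfolding cnt by (simp add: h_def)
        ultimately show "\<beta> \<in> ?g ` multisets_of_size UNIV d" by (metis imageI)
      qed
    qed
  qed
  then have "card (multi_indices d :: ('i \<Rightarrow> nat) set)
      = card (multisets_of_size (UNIV :: 'i option set) d)"
    by (simp add: bij_betw_same_card)
  then show ?thesis
    by (simp add: card_multisets_of_size card_UNIV_option)
qed

lemma CARD_monomials:
  fixes e :: "'r::finite \<Rightarrow> 'n::finite + 'm::finite \<Rightarrow> nat"
  assumes "bij_betw e UNIV (multi_indices d)"
  shows "CARD('r) = (CARD('n) + CARD('m) + d) choose d"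
  using bij_betw_same_card[OF assms] by (simp add: card_multi_indices)

end

theory Submission
  imports Defs
begin

text \<open>
  The cost vector \<open>Phi_A \<mu>\<close> is the moment vector of the atomic measure with mass \<open>\<mu> i\<close> at
  \<open>y i\<close>, so it is admissible. Since it equals \<open>Phi \<lambda>\<close> with \<open>\<lambda> \<ge> 0\<close>, weak duality
  bounds the objective on the feasible set by \<open>\<lambda> \<bullet> \<ell>\<close>, while \<open>\<alpha> = 0\<close> is feasible because
  \<open>\<ell> \<ge> 0\<close>. The \<open>\<alpha>\<close> with \<open>q\<close> in the polynomial class form a subspace, and a linear
  functional bounded above on a nonempty set cut out of a subspace by finitely many linear
  inequalities attains its maximum.
\<close>

section \<open>Attainment in bounded linear programs\<close>

text \<open>
  Moving from a feasible point along an ascent direction that preserves its active constraints must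
  activate a new one, as the objective is bounded. Hence every feasible point is dominated by one
  (in \<open>W\<close>) whose active set determines the objective, and there are finitely many active sets.
\<close>

lemma linear_program_attains_max:
  fixes V :: "'a::real_vector set" and g :: "'i \<Rightarrow> 'a \<Rightarrow> real" and b :: "'i \<Rightarrow> real"
    and c :: "'a \<Rightarrow> real"
  assumes V: "subspace V" and I: "finite I"
    and g: "\<And>i. i \<in> I \<Longrightarrow> linear (g i)" and c: "linear c"
  defines "F \<equiv> {p \<in> V. \<forall>i\<in>I. g i p \<le> b i}"
  assumes ne: "F \<noteq> {}" and bound: "\<And>p. p \<in> F \<Longrightarrow> c p \<le> B"
  shows "\<exists>p\<in>F. \<forall>q\<in>F. c q \<le> c p"
proof -
  define act where "act p = {i \<in> I. g i p = b i}" for p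
  define W where "W = {p \<in> F. \<forall>q\<in>V. (\<forall>i\<in>act p. g i q = b i) \<longrightarrow> c q = c p}"
  have fin_act: "finite (act p)" for p
    using I by (simp add: act_def)
  have dominated: "\<exists>p'\<in>W. c p \<le> c p'" if p: "p \<in> F" for p
  proof -
    have "card (act q) \<le> card I" for q
      unfolding act_def using I by (intro card_mono) auto
    then have "\<forall>q. q \<in> F \<and> c p \<le> c q \<longrightarrow> card (act q) < Suc (card I)"
      by (simp add: less_Suc_eq_le)
    \<comment> \<open>Extremal choice: \<open>p'\<close> has the largest active set among the
      feasible points at least as good as \<open>p\<close>. The \<open>Suc\<close> gives the strict
      bound that \<open>ex_has_greatest_nat\<close> asks for.\<close>
    then obtain p' where p': "p' \<in> F" "c p \<le> c p'"
      and greatest: "\<And>q. q \<in> F \<Longrightarrow> c p \<le> c q \<Longrightarrow> card (act q) \<le> card (act p')"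
      using ex_has_greatest_nat[of "\<lambda>q. q \<in> F \<and> c p \<le> c q" p "\<lambda>q. card (act q)" "Suc (card I)"] p
      by auto
    have no_ascent: "c h \<le> 0" if h: "h \<in> V" "\<And>i. i \<in> act p' \<Longrightarrow> g i h = 0" for h
    proof (rule ccontr)
      assume "\<not> c h \<le> 0"
      then have ch: "0 < c h" by simp
      \<comment> \<open>\<open>J\<close> holds the constraints that tighten along \<open>h\<close>;
        all others permit steps of any length.\<close>
      define J where "J = {i \<in> I. 0 < g i h}"
      have inV: "p' + t *\<^sub>R h \<in> V" for t
        using V p'(1) h(1) by (simp add: F_def subspace_add subspace_scale)
      have g_step: "g i (p' + t *\<^sub>R h) = g i p' + t * g i h" if "i \<in> I" for i t
        using g[OF that] by (simp add: linear_add linear_scale)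
      have c_step: "c (p' + t *\<^sub>R h) = c p' + t * c h" for t
        using c by (simp add: linear_add linear_scale)
      have p'_le: "g i p' \<le> b i" if "i \<in> I" for i
        using p'(1) that by (simp add: F_def)
      have step_outside_J: "g i p' + t * g i h \<le> b i" if "i \<in> I" "i \<notin> J" "0 \<le> t" for i t
      proof -
        have "t * g i h \<le> 0"
          using that by (simp add: J_def mult_nonneg_nonpos)
        then show ?thesis using p'_le[OF that(1)] by simp
      qed
      show False
      proof (cases "J = {}")
        case True
        \<comment> \<open>This step length lifts the objective to \<open>B + 1\<close>.\<close>
        define t where "t = (B - c p' + 1) / c h"
        have "0 \<le> t" using bound[OF p'(1)] ch by (simp add: t_def)
        then have "p' + t *\<^sub>R h \<in> F"
          using inV g_step step_outside_J True by (auto simp: F_def)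
        then have "c p' + t * c h \<le> B" using bound c_step by metis
        then show False using ch by (simp add: t_def)
      next
        case False
        \<comment> \<open>Ratio test, as in the simplex method: \<open>r i\<close> is the step at
          which constraint \<open>i\<close> becomes tight, so the least one is the longest feasible
          step. Its minimiser \<open>j\<close> is newly active, since \<open>g j h > 0\<close>
          whereas \<open>g i h = 0\<close> on the old active set.\<close>
        define r where "r i = (b i - g i p') / g i h" for i
        define t where "t = Min (r ` J)"
        have finJ: "finite J" using I by (simp add: J_def)
        have "t \<in> r ` J" unfolding t_def using finJ False by (intro Min_in) auto
        then obtain j where j: "j \<in> J" "t = r j" by auto
        have t0: "0 \<le> t"
          using j p'_le[of j] by (simp add: r_def J_def)
        have "g i p' + t * g i h \<le> b i" if "i \<in> J" for i
        proof -
          have "t \<le> r i" unfolding t_def using finJ that by simp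
          then show ?thesis using that by (simp add: r_def J_def field_simps)
        qed
        then have "\<forall>i\<in>I. g i p' + t * g i h \<le> b i"
          using step_outside_J t0 by blast
        then have feas: "p' + t *\<^sub>R h \<in> F"
          using inV g_step by (simp add: F_def)
        have "act p' \<subseteq> act (p' + t *\<^sub>R h)"
          using h(2) g_step by (auto simp: act_def)
        moreover have "j \<in> act (p' + t *\<^sub>R h)"
          using j g_step by (simp add: act_def r_def J_def)
        moreover have "j \<notin> act p'"
          using h(2)[of j] j by (auto simp: J_def)
        ultimately have "card (act p') < card (act (p' + t *\<^sub>R h))"
          by (intro psubset_card_mono fin_act) auto
        moreover have "c p \<le> c (p' + t *\<^sub>R h)"
          using c_step p'(2) t0 ch by (simp add: add_increasing2)
        ultimately show False using greatest[OF feas] by simp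
      qed
    qed
    \<comment> \<open>Both \<open>q - p'\<close> and \<open>p' - q\<close> preserve the active
      constraints, so neither direction increases the objective.\<close>
    have "c q = c p'" if q: "q \<in> V" "\<forall>i\<in>act p'. g i q = b i" for q
    proof (rule antisym)
      have V': "p' \<in> V" using p'(1) by (simp add: F_def)
      have act': "i \<in> I \<and> g i p' = b i \<and> g i q = b i" if "i \<in> act p'" for i
        using that q(2) by (auto simp: act_def)
      have "c (q - p') \<le> 0"
        using V V' q(1) act' g by (intro no_ascent) (auto simp: subspace_diff linear_diff)
      then show "c q \<le> c p'" using c by (simp add: linear_diff)
      have "c (p' - q) \<le> 0"
        using V V' q(1) act' g by (intro no_ascent) (auto simp: subspace_diff linear_diff)
      then show "c p' \<le> c q" using c by (simp add: linear_diff)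
    qed
    then show ?thesis using p' by (auto simp: W_def)
  qed
  have same_act: "c p = c q" if "p \<in> W" "q \<in> W" "act p = act q" for p q
  proof -
    have "\<forall>i\<in>act q. g i p = b i" using that(3) by (auto simp: act_def)
    then show ?thesis using that(1,2) by (simp add: W_def F_def)
  qed
  \<comment> \<open>One representative per active set yields every value of \<open>c\<close> on
    \<open>W\<close>. For subsets of \<open>I\<close> that are no such active set the choice is
    arbitrary, which is harmless for an inclusion.\<close>
  have "c ` W \<subseteq> (\<lambda>A. c (SOME p. p \<in> W \<and> act p = A)) ` Pow I"
  proof
    fix s assume "s \<in> c ` W"
    then obtain p where p: "p \<in> W" "s = c p" by auto
    have "(SOME q. q \<in> W \<and> act q = act p) \<in> W \<and> act (SOME q. q \<in> W \<and> act q = act p) = act p"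
      by (rule someI[of _ p]) (use p in simp)
    then have "s = c (SOME q. q \<in> W \<and> act q = act p)"
      using same_act p by metis
    moreover have "act p \<in> Pow I" by (auto simp: act_def)
    ultimately show "s \<in> (\<lambda>A. c (SOME p. p \<in> W \<and> act p = A)) ` Pow I" by blast
  qed
  then have fin: "finite (c ` W)"
    using I by (meson finite_Pow_iff finite_imageI finite_subset)
  moreover have "c ` W \<noteq> {}" using ne dominated by blast
  ultimately have "Max (c ` W) \<in> c ` W" by (rule Max_in)
  then obtain p where p: "p \<in> W" "c p = Max (c ` W)" by auto
  have "c q \<le> c p" if "q \<in> F" for q
    using dominated[OF that] Max_ge[OF fin] p(2) by force
  then show ?thesis using p(1) by (auto simp: W_def)
qed

section \<open>Features and the atomic measure\<close>

lemma continuous_on_phi: "continuous_on A (phi e)"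
proof -
  have "continuous_on A (\<lambda>z. coord z i)" for i
    by (cases i) (auto simp: coord_def intro!: continuous_intros)
  then show ?thesis
    unfolding phi_def vectorize_def outer_def pvec_def monomial_def
    by (auto intro!: continuous_intros)
qed

lemma measurable_phi: "phi e \<in> borel_measurable (restrict_space borel Z)"
  by (intro borel_measurable_continuous_onI measurable_restrict_space1 continuous_on_phi)

lemma Phi_A_mult_vec: "Phi_A e y *v mu = (\<Sum>i\<in>UNIV. mu $ i *\<^sub>R phi e (y i))"
  by (simp add: vec_eq_iff Phi_A_def matrix_vector_mult_def mult.commute)

text \<open>Pushing a weighted counting measure on the index type forward along \<open>y\<close>
  turns every integral into a finite sum; coinciding sample points simply add their masses.\<close>

lemma atomic_measure_representing_Phi_A:
  fixes y :: "'M::finite \<Rightarrow> (real^'n::finite) \<times> (real^'m::finite)" and mu :: "real^'M"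
  assumes y: "\<And>i. y i \<in> Z" and mu: "0 \<le> mu" "mu \<noteq> 0"
    and w_meas: "w \<in> borel_measurable (restrict_space borel Z)"
  shows "\<exists>c\<in>M_plus w Z. has_bochner_integral c (phi e) (Phi_A e y *v mu)"
proof -
  define P where "P = point_measure (UNIV :: 'M set) (\<lambda>i. ennreal (mu $ i))"
  define R where "R = restrict_space (borel :: ((real^'n) \<times> (real^'m)) measure) Z"
  define c where "c = distr P R y"
  have mu_nonneg: "0 \<le> mu $ i" for i
    using mu(1) by (simp add: less_eq_vec_def)
  \<comment> \<open>Every subset of the index type is measurable for \<open>P\<close>, so only the
    range of \<open>y\<close> matters.\<close>
  have y_meas: "y \<in> measurable P R"
    using y by (simp add: P_def R_def space_restrict_space measurable_def)
  have space_R: "space R = Z"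
    by (simp add: R_def space_restrict_space)
  have total: "emeasure c Z = (\<Sum>i\<in>UNIV. ennreal (mu $ i))"
  proof -
    have "emeasure c Z = emeasure P (y -` Z \<inter> space P)"
      unfolding c_def using y_meas space_R by (intro emeasure_distr) auto
    also have "y -` Z \<inter> space P = UNIV"
      using y by (auto simp: P_def space_point_measure)
    finally show ?thesis by (simp add: P_def emeasure_point_measure_finite)
  qed
  obtain i where "mu $ i \<noteq> 0" using mu(2) by (auto simp: vec_eq_iff)
  then have "0 < ennreal (mu $ i)" using mu_nonneg[of i] by simp
  also have "\<dots> \<le> emeasure c Z"
    unfolding total by (intro member_le_sum) auto
  finally have pos: "0 < emeasure c Z" .
  have "finite_measure c"
    by (rule finite_measureI) (use total space_R in \<open>simp add: c_def\<close>)
  moreover have "(\<integral>\<^sup>+t. ennreal (w t) \<partial>c) < \<infinity>"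
  proof -
    have "(\<integral>\<^sup>+t. ennreal (w t) \<partial>c) = (\<integral>\<^sup>+i. ennreal (w (y i)) \<partial>P)"
      unfolding c_def using y_meas w_meas by (intro nn_integral_distr) (auto simp: R_def)
    also have "\<dots> = (\<Sum>i\<in>UNIV. ennreal (mu $ i) * ennreal (w (y i)))"
      by (simp add: P_def nn_integral_point_measure_finite mult.commute)
    also have "\<dots> < \<infinity>" by (simp add: ennreal_mult_less_top)
    finally show ?thesis .
  qed
  ultimately have "c \<in> M_plus w Z"
    using pos by (simp add: M_plus_def c_def R_def)
  moreover have "has_bochner_integral P (\<lambda>i. phi e (y i)) (Phi_A e y *v mu)"
    unfolding has_bochner_integral_iff P_def Phi_A_mult_vec
    by (simp add: integrable_point_measure_finite lebesgue_integral_point_measure_finite mu_nonneg)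
  then have "has_bochner_integral c (phi e) (Phi_A e y *v mu)"
    unfolding c_def using measurable_phi y_meas
    by (subst has_bochner_integral_distr) (auto simp: R_def)
  ultimately show ?thesis by blast
qed

section \<open>The subspace of admissible coefficients\<close>

text \<open>Bounds on the weighted sup-norm add and scale; positivity of \<open>w\<close> on
  \<open>Z\<close> lets the triangle inequality survive the division.\<close>

lemma
  assumes "\<And>t. t \<in> Z \<Longrightarrow> 0 < w t"
  shows zero_in_S_space: "(\<lambda>t. 0) \<in> S_space w Z"
    and add_in_S_space: "q \<in> S_space w Z \<Longrightarrow> q' \<in> S_space w Z \<Longrightarrow> (\<lambda>t. q t + q' t) \<in> S_space w Z"
    and scale_in_S_space: "q \<in> S_space w Z \<Longrightarrow> (\<lambda>t. k * q t) \<in> S_space w Z"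
proof -
  show "(\<lambda>t. 0) \<in> S_space w Z"
    by (auto simp: S_space_def intro!: bdd_aboveI[of _ 0])
  show "(\<lambda>t. q t + q' t) \<in> S_space w Z" if q: "q \<in> S_space w Z" "q' \<in> S_space w Z"
  proof -
    obtain C C' where C: "\<And>t. t \<in> Z \<Longrightarrow> \<bar>q t\<bar> / w t \<le> C" "\<And>t. t \<in> Z \<Longrightarrow> \<bar>q' t\<bar> / w t \<le> C'"
      using q by (auto simp: S_space_def bdd_above_def)
    have "\<bar>q t + q' t\<bar> / w t \<le> C + C'" if "t \<in> Z" for t
    proof -
      have "\<bar>q t + q' t\<bar> / w t \<le> \<bar>q t\<bar> / w t + \<bar>q' t\<bar> / w t"
        using assms[OF that] by (simp add: add_divide_distrib[symmetric] divide_right_mono)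
      then show ?thesis using C[OF that] by linarith
    qed
    then show ?thesis using q by (auto simp: S_space_def intro!: bdd_aboveI)
  qed
  show "(\<lambda>t. k * q t) \<in> S_space w Z" if q: "q \<in> S_space w Z"
  proof -
    obtain C where C: "\<And>t. t \<in> Z \<Longrightarrow> \<bar>q t\<bar> / w t \<le> C"
      using q by (auto simp: S_space_def bdd_above_def)
    have "\<bar>k * q t\<bar> / w t \<le> \<bar>k\<bar> * C" if "t \<in> Z" for t
      using mult_left_mono[OF C[OF that], of "\<bar>k\<bar>"] by (simp add: abs_mult)
    then show ?thesis using q by (auto simp: S_space_def intro!: bdd_aboveI)
  qed
qed

text \<open>On an unbounded \<open>Z\<close> the growth of \<open>w\<close> may exclude some
  polynomials. Both this restriction and symmetry are linear conditions on \<alpha>, and the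
  quadratic form then comes for free with \<open>unvectorize \<alpha>\<close> as its matrix.\<close>

lemma subspace_symmetric_S_poly:
  assumes w_pos: "\<And>t. t \<in> Z \<Longrightarrow> 0 < w t"
  shows "subspace {\<alpha>. (\<exists>Q. transpose Q = Q \<and> \<alpha> = vectorize Q) \<and> (\<lambda>t. \<alpha> \<bullet> phi e t) \<in> S_poly e w Z}"
proof -
  have "{\<alpha>. (\<exists>Q. transpose Q = Q \<and> \<alpha> = vectorize Q) \<and> (\<lambda>t. \<alpha> \<bullet> phi e t) \<in> S_poly e w Z} =
      {\<alpha>. (\<forall>i j. \<alpha> $ (i, j) = \<alpha> $ (j, i)) \<and> (\<lambda>t. \<alpha> \<bullet> phi e t) \<in> S_space w Z}" (is "?L = ?R")
  proof
    show "?L \<subseteq> ?R"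
      by (auto simp: S_poly_def vectorize_def transpose_def vec_eq_iff)
    show "?R \<subseteq> ?L"
    proof
      fix \<alpha> assume a: "\<alpha> \<in> ?R"
      have sym: "transpose (unvectorize \<alpha>) = unvectorize \<alpha>"
        using a by (simp add: transpose_def unvectorize_def vec_eq_iff)
      have "\<alpha> \<bullet> phi e t = pvec e t \<bullet> (unvectorize \<alpha> *v pvec e t)" for t
        using inner_vectorize_phi[of "unvectorize \<alpha>" e t] by (simp add: vectorize_unvectorize)
      then show "\<alpha> \<in> ?L"
        using a sym vectorize_unvectorize[of \<alpha>] unfolding S_poly_def by force
    qed
  qed
  also have "subspace ?R"
    using zero_in_S_space[of Z w] add_in_S_space[of Z w] scale_in_S_space[of Z w] w_pos
    by (simp add: subspace_def inner_add_left)
  finally show ?thesis .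
qed

section \<open>Weak duality and the finite value\<close>

text \<open>A cost vector in the cone spanned by the columns of \<open>A\<close> carries its own
  dual certificate \<open>lam\<close>, which bounds the objective by
  \<open>b \<bullet> lam\<close>.\<close>

lemma lp_finite_conic_cost:
  fixes A :: "real^'N::finite^('r::finite \<times> 'r)"
  assumes w_pos: "\<And>t. t \<in> Z \<Longrightarrow> 0 < w t"
    and b: "0 \<le> b" and lam: "0 \<le> lam"
    and c: "(\<integral>t. phi e t \<partial>c) = A *v lam"
  shows "lp_finite e w Z A b c"
proof -
  define V where
    "V = {\<alpha>. (\<exists>Q. transpose Q = Q \<and> \<alpha> = vectorize Q) \<and> (\<lambda>t. \<alpha> \<bullet> phi e t) \<in> S_poly e w Z}"
  have V: "subspace V"
    unfolding V_def using w_pos by (rule subspace_symmetric_S_poly)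
  have feasible: "lp_feasible e w Z A b = {\<alpha> \<in> V. \<forall>i\<in>UNIV. (transpose A *v \<alpha>) $ i \<le> b $ i}"
    by (auto simp: lp_feasible_def V_def less_eq_vec_def)
  have objective: "lp_objective e c \<alpha> = (transpose A *v \<alpha>) \<bullet> lam" for \<alpha>
    by (simp add: lp_objective_def c dot_lmul_matrix[symmetric])
  have "0 \<in> lp_feasible e w Z A b"
    using subspace_0[OF V] b by (simp add: feasible less_eq_vec_def)
  then have ne: "lp_feasible e w Z A b \<noteq> {}" by blast
  \<comment> \<open>Each constraint is weighted by its multiplier \<open>lam $ i \<ge> 0\<close> and
    the results are summed.\<close>
  have bound: "lp_objective e c \<alpha> \<le> b \<bullet> lam" if "\<alpha> \<in> lp_feasible e w Z A b" for \<alpha>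
    using that lam unfolding objective feasible inner_vec_def
    by (auto simp: less_eq_vec_def intro!: sum_mono mult_right_mono)
  have "\<exists>\<alpha>\<in>lp_feasible e w Z A b. \<forall>\<beta>\<in>lp_feasible e w Z A b.
      lp_objective e c \<beta> \<le> lp_objective e c \<alpha>"
    unfolding feasible
  proof (rule linear_program_attains_max[OF V finite[of UNIV]])
    show "linear (\<lambda>\<alpha>. (transpose A *v \<alpha>) $ i)" for i
      by (intro linearI) (auto simp: matrix_vector_right_distrib matrix_vector_mult_scaleR)
    show "linear (lp_objective e c)"
      by (intro linearI) (auto simp: lp_objective_def inner_add_left)
  qed (use ne bound in \<open>unfold feasible, auto\<close>)
  then obtain \<alpha> where \<alpha>: "\<alpha> \<in> lp_feasible e w Z A b"
    "\<And>\<beta>. \<beta> \<in> lp_feasible e w Z A b \<Longrightarrow> lp_objective e c \<beta> \<le> lp_objective e c \<alpha>"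
    by blast
  have "lp_value e w Z A b c = ereal (lp_objective e c \<alpha>)"
    unfolding lp_value_def using \<alpha> by (intro antisym SUP_least SUP_upper) auto
  then show ?thesis
    using \<alpha>(1) by (auto simp: lp_finite_def)
qed

text \<open>The cost vector is prescribed through \<open>has_bochner_integral\<close> because the
  integral of a non-integrable function is 0 by convention. The existence claim keeps the universal
  one from being vacuous.\<close>

theorem proposition3:
  fixes X :: "(real^'n) set" and U :: "(real^'m) set" and Z :: "((real^'n) \<times> (real^'m)) set"
    and f :: "(real^'n) \<times> (real^'m) \<Rightarrow> real^'n"
    and l :: "(real^'n) \<times> (real^'m) \<Rightarrow> real"
    and w :: "(real^'n) \<times> (real^'m) \<Rightarrow> real"
    and \<gamma> :: real and d :: nat
    and e :: "'r::finite \<Rightarrow> 'n + 'm \<Rightarrow> nat"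
    and x :: "'N::finite \<Rightarrow> real^'n" and u v :: "'N \<Rightarrow> real^'m"
    and z zp :: "'N \<Rightarrow> (real^'n) \<times> (real^'m)"
    and y :: "'M::finite \<Rightarrow> (real^'n) \<times> (real^'m)"
    and ell :: "real^'N" and lam :: "real^'N" and mu :: "real^'M"
  assumes Z: "Z = X \<times> U"
    and f: "\<And>s a. s \<in> X \<Longrightarrow> a \<in> U \<Longrightarrow> f (s, a) \<in> X"
    and l: "\<And>s a. s \<in> X \<Longrightarrow> a \<in> U \<Longrightarrow> 0 \<le> l (s, a)"
    and \<gamma>: "0 < \<gamma>" "\<gamma> < 1"
    and w_pos: "\<And>t. t \<in> Z \<Longrightarrow> 0 < w t"
    and w_meas: "w \<in> borel_measurable (restrict_space borel Z)"
    and e: "bij_betw e UNIV (multi_indices d)"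
    and data: "\<And>i. x i \<in> X" "\<And>i. u i \<in> U" "\<And>i. v i \<in> U"
    and z: "\<And>i. z i = (x i, u i)"
    and zp: "\<And>i. zp i = (f (x i, u i), v i)"
    and ell: "ell = (\<chi> i. l (z i))"
    and y: "\<And>i. y i \<in> Z"
    and lam: "0 \<le> lam" "lam \<noteq> 0"
    and mu: "0 \<le> mu" "mu \<noteq> 0"
    and eq: "unvectorize (Phi e \<gamma> z zp *v lam) = unvectorize (Phi_A e y *v mu)"
  shows "Phi e \<gamma> z zp *v lam = Phi_A e y *v mu \<and>
    (\<exists>c\<in>M_plus w Z. has_bochner_integral c (phi e) (Phi e \<gamma> z zp *v lam)) \<and>
    (\<forall>c\<in>M_plus w Z. has_bochner_integral c (phi e) (Phi e \<gamma> z zp *v lam) \<longrightarrow>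
       lp_finite e w Z (Phi e \<gamma> z zp) ell c)"
proof -
  have cost: "Phi e \<gamma> z zp *v lam = Phi_A e y *v mu"
    using eq by (metis vectorize_unvectorize)
  \<comment> \<open>Nonnegative stage costs make \<alpha> = 0 feasible.\<close>
  have "0 \<le> ell"
    using l data z by (simp add: ell less_eq_vec_def)
  then have "lp_finite e w Z (Phi e \<gamma> z zp) ell c"
    if "has_bochner_integral c (phi e) (Phi e \<gamma> z zp *v lam)" for c
    using that w_pos lam(1)
    by (intro lp_finite_conic_cost[where lam = lam]) (auto simp: has_bochner_integral_integral_eq)
  moreover have "\<exists>c\<in>M_plus w Z. has_bochner_integral c (phi e) (Phi_A e y *v mu)"
    using y mu w_meas by (rule atomic_measure_representing_Phi_A)
  ultimately show ?thesis
    using cost by simp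
qed

end
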